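(* Consider $M$ subsystems controlled by the switched-cost DMPC scheme with compatibility constraints (Algorithm 2) described in the context, under the standing assumptions listed there. There exists a configuration of the sets $\bar{\mathcal X}_0^i\subseteq\mathcal X_0^i$, one for each subsystem $i=1,\dots,M$, such that: (i) the subsystems applying the control law of Algorithm 2 with initial conditions $x_0^i\in\bar{\mathcal X}_0^i$ have no intersections in the spatial subspace, i.e. $\bigcap_{i=1}^M\mathcal S_0^i=\emptyset$; (ii) there exists $r'>0$ such that, for every subsystem $i$, the state shift from $0$ to any avoidance state $\bar x\in\mathcal B_{r'}(0)$ and back to $0$, carried out by change of coordinates and using the decoupled MPC, stays in $\bar{\mathcal X}_0^i$.
   Context: Notation. $\mathbb Z^+$ is the set of nonnegative integers; $\|\cdot\|$ is the Euclidean norm; $\|x\|_P^2=x^TPx$; $\mathcal B_\rho(0)=\{x\in\mathbb R^n:\|x\|\le\rho\}$. Subsystems. There are $M\ge2$ subsystems with absolute states $\zeta^i\in\mathbb R^n$ and reference states $\hat\zeta^i$; the offsets $d_{i,j}=\hat\zeta^i-\hat\zeta^j$ are the desired relative configuration. The errors $x^i=\zeta^i-\hat\zeta^i$ and input errors $u^i\in\mathbb R^m$ obey $x^i(t+1)=Ax^i(t)+Bu^i(t)$, where $(A,B)$ is controllable and $B$ has full column rank, subject to $x^i(t)\in\mathcal X^i\subset\mathbb R^n$, $u^i(t)\in\mathcal U^i\subset\mathbb R^m$. Subsystems interact over a fixed undirected graph on $\{1,\dots,M\}$ in which any two vertices are joined by a path; $\mathcal N^i$ is the set of neighbors $j\ne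 i$ of $i$. A subset of the coordinates of $\zeta$ is spatial (position), and $\perp_s$ denotes projection of a set onto the spatial subspace. The subsystems are spatially distributed: the spatial parts of the reference states of different subsystems are distinct. $\mathcal S_0^i=\perp_s(\{\hat\zeta^i+x:x\in\bar{\mathcal X}_0^i\})$. The measured state at time $t$ is $x_t^i$; $x_{k,t}^i$ is the state predicted at time $t$ for time $t+k$, with $x_{0,t}^i=x_t^i$; $u_{k,t}^i$ is the predicted input. Bold symbols collect a variable over the prediction horizon $N\ge2$. The superscript $*$ denotes optimizers. Standing assumptions. For each $i$, the sets $\mathcal X^i,\bar{\mathcal X}_0^i,\mathcal X_f^i\subseteq\mathcal X^i,\mathcal U^i$ are convex compact polyhedra containing the origin as an interior point, and the constraint sets of different subsystems are decoupled. $Q=Q^T\succ0$, $R=R^T\succ0$, $Q_e=q_eI$ with $q_e>0$. There are a linear state feedback $u=Kx$ and $P\succ0$ such that for all $x\in\mathcal X_f$: $u=Kx\in\mathcal U$, $Ax+Bu\in\mathcal X_f$ and $-\|x\|_P^2+\|x\|_Q^2+\|u\|_R^2+\|Ax+Bu\|_P^2\le0$ (for each subsystem). $P_e=P_e^T\succ0$ satisfies $-\|x\|_{P_e}^2+\|x\|_{Q_e}^2+\|(A+BK)x\|_{P_e}^2<0$ for all $x\neq0$. $\mathcal X_0^i$ is the $N$-step backward reachable set of $\mathcal X_f^i$ in $\mathcal X^i$ (states from which some inputs in $\mathcal U^i$ keep the state in $\mathcal X^i$ and bring it into $\mathcal X_f^i$ in $N$ steps). $\bar{\mathcal X}_0^i$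 is a control invariant polyhedron with $\mathcal X_f^i\subseteq\bar{\mathcal X}_0^i\subseteq\mathcal X_0^i$. $\rho_{\max}$ is an upper bound on $\|x^i\|$ over all $x^i\in\mathcal X^i$, $i=1,\dots,M$. Coupled problem for subsystem $i$ at time $t$: minimize over $\boldsymbol u_t^i$ $$\sum_{k=0}^{N-1}\Big(\|x_{k,t}^i\|_Q^2+\|u_{k,t}^i\|_R^2+\sum_{j\in\mathcal N^i}\|x_{k,t}^i-\hat x_{k,t}^j\|_{Q_e}^2\Big)+\|x_{N,t}^i\|_P^2+\sum_{j\in\mathcal N^i}\|x_{N,t}^i-\hat x_{N,t}^j\|_{P_e}^2$$ subject to $x_{k+1,t}^i=Ax_{k,t}^i+Bu_{k,t}^i$, $x_{k,t}^i\in\mathcal X^i$, $u_{k,t}^i\in\mathcal U^i$ ($k=0,\dots,N-1$), $x_{N,t}^i\in\mathcal X_f^i$ (the trajectories used for the neighbors being required to satisfy the analogous dynamics and constraints). Compatibility constraints for subsystem $i$ at time $t$: $x_{N,t}^i=\hat x_{N,t}^i$ and $\|x_{k,t}^i-\hat x_{k,t}^i\|\le\min_{j\in\mathcal N^i}\frac{\|x_{t-1}^i-x_{t-1}^j\|^2}{4(N-1)\rho_{\max}}$ for $k=0,\dots,N$. Decoupled problem (decoupled MPC) for subsystem $i$ at time $t$: minimize over $\boldsymbol u_t^i$ the cost $\sum_{k=0}^{N-1}(\|x_{k,t}^i\|_Q^2+\|u_{k,t}^i\|_R^2)+\|x_{N,t}^i\|_P^2$ subject to $x_{k+1,t}^i=Ax_{k,t}^i+Bu_{k,t}^i$,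 $x_{k,t}^i\in\bar{\mathcal X}_0^i$, $x_{N,t}^i\in\mathcal X_f^i$, $u_{k,t}^i\in\mathcal U^i$; the first optimal input is applied. Algorithm 2. (1) Initialization, at a time $0^-$ immediately preceding $t=0$: every subsystem solves the coupled problem with $q_e=0$ and $P_e=0$ (without compatibility constraints) and applies the first input of the optimizer. (2) At each $t\in\mathbb Z^+$, the presumed trajectory of each $j$ is $\hat{\boldsymbol x}_t^j=(x_{1,t-1}^{j*},\dots,x_{N,t-1}^{j*},(A+BK)x_{N,t-1}^{j*})$ ($t-1$ meaning $0^-$ when $t=0$). (3) If $x_t^i\notin\mathcal X_f^i$ for some $i$, every subsystem solves the coupled problem with the compatibility constraints added; otherwise every subsystem solves the decoupled problem. (4) Each subsystem applies $u_t^i=u_{0,t}^{i*}$. (5) Repeat from (2) at time $t+1$. State shift. The shift from $0$ to $\bar x$ by change of coordinates means running the decoupled MPC in the translated error coordinate $y=x-\bar x$ (i.e. moving the reference by $\bar x$; $y$ obeys $y(t+1)=Ay(t)+Bu(t)$), from $y(0)=-\bar x$, the resulting states being $x(t)=y(t)+\bar x$; the shift back to $0$ means running the decoupled MPC in the original coordinates from $x(0)=\bar x$.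
   Formalization: If the given terminal sets, placed at the reference states, share a common spatial point, (i) is impossible; in that case they are replaced by smaller terminal sets satisfying the same assumptions. Otherwise the given terminal sets are kept. *)

theory Defs
  imports "HOL-Analysis.Analysis"
begin

text \<open>The subsystems are indexed by a finite type \<open>'i\<close>; states live in \<open>real ^ 'n\<close> and inputs in
  \<open>real ^ 'm\<close>. The fixed data of the control problem are collected in one record; the terminal sets
  and the sets \<open>X0bar\<close> are kept as separate arguments because they are design choices: as
  \<open>Xf i \<subseteq> X0bar i\<close>, disjointness of the \<open>X0bar i\<close> in space is impossible for terminal sets
  that already intersect there, and then these have to be replaced by smaller ones.\<close>

record ('n::finite, 'm::finite, 'i::finite) dmpc =
  dynA    :: "real ^ 'n ^ 'n"
  dynB    :: "real ^ 'm ^ 'n"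
  stateX  :: "'i \<Rightarrow> (real ^ 'n) set"
  inputU  :: "'i \<Rightarrow> (real ^ 'm) set"
  refst   :: "'i \<Rightarrow> real ^ 'n"
  spat    :: "'n set"
  adj     :: "'i \<Rightarrow> 'i \<Rightarrow> bool"
  horizon :: nat
  wQ      :: "real ^ 'n ^ 'n"
  wR      :: "real ^ 'm ^ 'm"
  wqe     :: real
  gainK   :: "real ^ 'n ^ 'm"
  wP      :: "real ^ 'n ^ 'n"
  wPe     :: "real ^ 'n ^ 'n"
  rhomax  :: real

definition posdef :: "real ^ 'k ^ 'k \<Rightarrow> bool" where
  "posdef S \<longleftrightarrow> transpose S = S \<and> (\<forall>x. x \<noteq> 0 \<longrightarrow> 0 < x \<bullet> (S *v x))"

definition wnorm2 :: "real ^ 'k ^ 'k \<Rightarrow> real ^ 'k \<Rightarrow> real" where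
  "wnorm2 S x = x \<bullet> (S *v x)"

primrec traj :: "real ^ 'n ^ 'n \<Rightarrow> real ^ 'm ^ 'n \<Rightarrow> real ^ 'n \<Rightarrow> (nat \<Rightarrow> real ^ 'm) \<Rightarrow> nat \<Rightarrow> real ^ 'n" where
  "traj A B x u 0 = x"
| "traj A B x u (Suc k) = A *v traj A B x u k + B *v u k"

text \<open>For discrete time: every state can be steered to every other one in finitely many steps.\<close>

definition controllable :: "real ^ 'n ^ 'n \<Rightarrow> real ^ 'm ^ 'n \<Rightarrow> bool" where
  "controllable A B \<longleftrightarrow> (\<forall>x y. \<exists>T u. traj A B x u T = y)"

definition constraint_polyhedron :: "(real ^ 'k) set \<Rightarrow> bool" where
  "constraint_polyhedron S \<longleftrightarrow> polyhedron S \<and> convex S \<and> compact S \<and> 0 \<in> interior S"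

definition spatial :: "('n::finite, 'm::finite, 'i::finite) dmpc \<Rightarrow> real ^ 'n \<Rightarrow> real ^ 'n" where
  "spatial D z = (\<chi> k. if k \<in> spat D then z $ k else 0)"

definition nbrs :: "('n::finite, 'm::finite, 'i::finite) dmpc \<Rightarrow> 'i \<Rightarrow> 'i set" where
  "nbrs D i = {j. j \<noteq> i \<and> adj D i j}"

definition predicted :: "('n::finite, 'm::finite, 'i::finite) dmpc \<Rightarrow> real ^ 'n \<Rightarrow> (nat \<Rightarrow> real ^ 'm) \<Rightarrow> nat \<Rightarrow> real ^ 'n" where
  "predicted D = traj (dynA D) (dynB D)"

definition standing_assumptions :: "('n::finite, 'm::finite, 'i::finite) dmpc \<Rightarrow> bool" where
  "standing_assumptions D \<longleftrightarrow>
     2 \<le> CARD('i) \<and> 2 \<le> horizon D \<and>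
     controllable (dynA D) (dynB D) \<and> rank (dynB D) = CARD('m) \<and>
     (\<forall>i j. adj D i j \<longrightarrow> adj D j i) \<and> (\<forall>i j. (adj D)\<^sup>*\<^sup>* i j) \<and>
     (\<forall>i j. i \<noteq> j \<longrightarrow> spatial D (refst D i) \<noteq> spatial D (refst D j)) \<and>
     (\<forall>i. constraint_polyhedron (stateX D i) \<and> constraint_polyhedron (inputU D i)) \<and>
     posdef (wQ D) \<and> posdef (wR D) \<and> 0 < wqe D \<and> posdef (wP D) \<and> posdef (wPe D) \<and>
     (\<forall>x. x \<noteq> 0 \<longrightarrow>
        - wnorm2 (wPe D) x + wnorm2 (mat (wqe D)) x
          + wnorm2 (wPe D) ((dynA D + dynB D ** gainK D) *v x) < 0) \<and>
     (\<forall>i. \<forall>x \<in> stateX D i. norm x \<le> rhomax D)"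

definition terminal_sets :: "('n::finite, 'm::finite, 'i::finite) dmpc \<Rightarrow> ('i \<Rightarrow> (real ^ 'n) set) \<Rightarrow> bool" where
  "terminal_sets D Xf \<longleftrightarrow>
     (\<forall>i. constraint_polyhedron (Xf i) \<and> Xf i \<subseteq> stateX D i \<and>
        (\<forall>x \<in> Xf i. let u = gainK D *v x; x' = dynA D *v x + dynB D *v u in
           u \<in> inputU D i \<and> x' \<in> Xf i \<and>
           - wnorm2 (wP D) x + wnorm2 (wQ D) x + wnorm2 (wR D) u + wnorm2 (wP D) x' \<le> 0))"

definition traj_feasible ::
  "('n::finite, 'm::finite, 'i::finite) dmpc \<Rightarrow> ('i \<Rightarrow> (real ^ 'n) set) \<Rightarrow> 'i \<Rightarrow> real ^ 'n \<Rightarrow> (nat \<Rightarrow> real ^ 'm) \<Rightarrow> bool" where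
  "traj_feasible D Xf i x u \<longleftrightarrow>
     (\<forall>k < horizon D. predicted D x u k \<in> stateX D i \<and> u k \<in> inputU D i) \<and>
     predicted D x u (horizon D) \<in> Xf i"

definition X0set :: "('n::finite, 'm::finite, 'i::finite) dmpc \<Rightarrow> ('i \<Rightarrow> (real ^ 'n) set) \<Rightarrow> 'i \<Rightarrow> (real ^ 'n) set" where
  "X0set D Xf i = {x. \<exists>u. traj_feasible D Xf i x u}"

definition X0bar_config ::
  "('n::finite, 'm::finite, 'i::finite) dmpc \<Rightarrow> ('i \<Rightarrow> (real ^ 'n) set) \<Rightarrow> ('i \<Rightarrow> (real ^ 'n) set) \<Rightarrow> bool" where
  "X0bar_config D Xf X0bar \<longleftrightarrow>
     (\<forall>i. constraint_polyhedron (X0bar i) \<and> Xf i \<subseteq> X0bar i \<and> X0bar i \<subseteq> X0set D Xf i \<and>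
        (\<forall>x \<in> X0bar i. \<exists>u \<in> inputU D i. dynA D *v x + dynB D *v u \<in> X0bar i))"

definition occupied :: "('n::finite, 'm::finite, 'i::finite) dmpc \<Rightarrow> ('i \<Rightarrow> (real ^ 'n) set) \<Rightarrow> 'i \<Rightarrow> (real ^ 'n) set" where
  "occupied D C i = spatial D ` ((\<lambda>x. refst D i + x) ` C i)"

text \<open>In the optimization problems a decision variable is an input sequence \<open>u\<close>, of which only the
  entries \<open>u k\<close> with \<open>k < horizon D\<close> matter. A family \<open>xh\<close> of trajectories has entries \<open>xh j k\<close>,
  \<open>k \<le> horizon D\<close>.\<close>

definition decoupled_cost :: "('n::finite, 'm::finite, 'i::finite) dmpc \<Rightarrow> real ^ 'n \<Rightarrow> (nat \<Rightarrow> real ^ 'm) \<Rightarrow> real" where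
  "decoupled_cost D x u =
     (\<Sum>k < horizon D. wnorm2 (wQ D) (predicted D x u k) + wnorm2 (wR D) (u k))
     + wnorm2 (wP D) (predicted D x u (horizon D))"

definition coupled_cost ::
  "('n::finite, 'm::finite, 'i::finite) dmpc \<Rightarrow> real ^ 'n ^ 'n \<Rightarrow> real ^ 'n ^ 'n \<Rightarrow> 'i
    \<Rightarrow> ('i \<Rightarrow> nat \<Rightarrow> real ^ 'n) \<Rightarrow> real ^ 'n \<Rightarrow> (nat \<Rightarrow> real ^ 'm) \<Rightarrow> real" where
  "coupled_cost D Qe Pe i xh x u =
     (\<Sum>k < horizon D. wnorm2 (wQ D) (predicted D x u k) + wnorm2 (wR D) (u k)
        + (\<Sum>j \<in> nbrs D i. wnorm2 Qe (predicted D x u k - xh j k)))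
     + wnorm2 (wP D) (predicted D x u (horizon D))
     + (\<Sum>j \<in> nbrs D i. wnorm2 Pe (predicted D x u (horizon D) - xh j (horizon D)))"

definition coupled_feasible ::
  "('n::finite, 'm::finite, 'i::finite) dmpc \<Rightarrow> ('i \<Rightarrow> (real ^ 'n) set) \<Rightarrow> 'i
    \<Rightarrow> ('i \<Rightarrow> nat \<Rightarrow> real ^ 'n) \<Rightarrow> real ^ 'n \<Rightarrow> (nat \<Rightarrow> real ^ 'm) \<Rightarrow> bool" where
  "coupled_feasible D Xf i xh x u \<longleftrightarrow>
     traj_feasible D Xf i x u \<and>
     (\<forall>j \<in> nbrs D i. \<exists>v. (\<forall>k \<le> horizon D. xh j k = predicted D (xh j 0) v k) \<and>
        traj_feasible D Xf j (xh j 0) v)"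

text \<open>\<open>xprev\<close> are the measured states of all subsystems at the previous time.\<close>

definition compatible ::
  "('n::finite, 'm::finite, 'i::finite) dmpc \<Rightarrow> 'i \<Rightarrow> ('i \<Rightarrow> real ^ 'n)
    \<Rightarrow> ('i \<Rightarrow> nat \<Rightarrow> real ^ 'n) \<Rightarrow> real ^ 'n \<Rightarrow> (nat \<Rightarrow> real ^ 'm) \<Rightarrow> bool" where
  "compatible D i xprev xh x u \<longleftrightarrow>
     predicted D x u (horizon D) = xh i (horizon D) \<and>
     (\<forall>k \<le> horizon D. norm (predicted D x u k - xh i k) \<le>
        Min ((\<lambda>j. (norm (xprev i - xprev j))\<^sup>2 / (4 * (real (horizon D) - 1) * rhomax D)) ` nbrs D i))"

definition coupled_optimal where
  "coupled_optimal D Xf i xprev xh x u \<longleftrightarrow>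
     is_arg_min (coupled_cost D (mat (wqe D)) (wPe D) i xh x)
       (\<lambda>u. coupled_feasible D Xf i xh x u \<and> compatible D i xprev xh x u) u"

text \<open>With vanishing coupling weights the cost does not depend on the neighbours' trajectories, so at
  the initialization any family of feasible ones may be used.\<close>

definition init_optimal where
  "init_optimal D Xf i x u \<longleftrightarrow>
     (\<exists>xh. is_arg_min (coupled_cost D 0 0 i xh x) (coupled_feasible D Xf i xh x) u)"

definition decoupled_optimal ::
  "('n::finite, 'm::finite, 'i::finite) dmpc \<Rightarrow> ('i \<Rightarrow> (real ^ 'n) set) \<Rightarrow> ('i \<Rightarrow> (real ^ 'n) set)
    \<Rightarrow> 'i \<Rightarrow> real ^ 'n \<Rightarrow> (nat \<Rightarrow> real ^ 'm) \<Rightarrow> bool" where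
  "decoupled_optimal D Xf X0bar i x u \<longleftrightarrow>
     is_arg_min (decoupled_cost D x)
       (\<lambda>u. (\<forall>k < horizon D. predicted D x u k \<in> X0bar i \<and> u k \<in> inputU D i) \<and>
            predicted D x u (horizon D) \<in> Xf i) u"

definition presumed ::
  "('n::finite, 'm::finite, 'i::finite) dmpc \<Rightarrow> ('i \<Rightarrow> real ^ 'n) \<Rightarrow> ('i \<Rightarrow> nat \<Rightarrow> real ^ 'm) \<Rightarrow> 'i \<Rightarrow> nat \<Rightarrow> real ^ 'n" where
  "presumed D x u j k =
     (if k < horizon D then predicted D (x j) (u j) (Suc k)
      else (dynA D + dynB D ** gainK D) *v predicted D (x j) (u j) (horizon D))"

text \<open>A run of the switched-cost algorithm: \<open>xm i\<close> and \<open>um i\<close> are the state and the optimal input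
  sequence at the initialization time \<open>0\<^sup>-\<close>, while \<open>x t i\<close> and \<open>u t i\<close> are the state and the optimal input
  sequence at time \<open>t\<close>.\<close>

definition alg_init ::
  "('n::finite, 'm::finite, 'i::finite) dmpc \<Rightarrow> ('i \<Rightarrow> (real ^ 'n) set)
    \<Rightarrow> ('i \<Rightarrow> real ^ 'n) \<Rightarrow> ('i \<Rightarrow> nat \<Rightarrow> real ^ 'm) \<Rightarrow> ('i \<Rightarrow> real ^ 'n) \<Rightarrow> bool" where
  "alg_init D Xf xm um x0 \<longleftrightarrow>
     (\<forall>i. init_optimal D Xf i (xm i) (um i) \<and> x0 i = dynA D *v xm i + dynB D *v um i 0)"

definition alg_run ::
  "('n::finite, 'm::finite, 'i::finite) dmpc \<Rightarrow> ('i \<Rightarrow> (real ^ 'n) set) \<Rightarrow> ('i \<Rightarrow> (real ^ 'n) set)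
    \<Rightarrow> ('i \<Rightarrow> real ^ 'n) \<Rightarrow> ('i \<Rightarrow> nat \<Rightarrow> real ^ 'm)
    \<Rightarrow> (nat \<Rightarrow> 'i \<Rightarrow> real ^ 'n) \<Rightarrow> (nat \<Rightarrow> 'i \<Rightarrow> nat \<Rightarrow> real ^ 'm) \<Rightarrow> bool" where
  "alg_run D Xf X0bar xm um x u \<longleftrightarrow>
     alg_init D Xf xm um (x 0) \<and>
     (\<forall>t. let xprev = (case t of 0 \<Rightarrow> xm | Suc s \<Rightarrow> x s);
              uprev = (case t of 0 \<Rightarrow> um | Suc s \<Rightarrow> u s)
          in if \<exists>i. x t i \<notin> Xf i
             then \<forall>i. coupled_optimal D Xf i xprev (presumed D xprev uprev) (x t i) (u t i)
             else \<forall>i. decoupled_optimal D Xf X0bar i (x t i) (u t i)) \<and>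
     (\<forall>t i. x (Suc t) i = dynA D *v x t i + dynB D *v u t i 0)"

definition decoupled_run ::
  "('n::finite, 'm::finite, 'i::finite) dmpc \<Rightarrow> ('i \<Rightarrow> (real ^ 'n) set) \<Rightarrow> ('i \<Rightarrow> (real ^ 'n) set)
    \<Rightarrow> 'i \<Rightarrow> (nat \<Rightarrow> real ^ 'n) \<Rightarrow> bool" where
  "decoupled_run D Xf X0bar i x \<longleftrightarrow>
     (\<forall>t. \<exists>u. decoupled_optimal D Xf X0bar i (x t) u \<and> x (Suc t) = dynA D *v x t + dynB D *v u 0)"

text \<open>The shift from \<open>0\<close> to \<open>xb\<close> runs the decoupled controller in the coordinate \<open>y = x - xb\<close>, with
  the constraint sets imposed on \<open>y\<close>; the shift back runs it in the original coordinate.\<close>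

definition shift_to where
  "shift_to D Xf X0bar i xb x \<longleftrightarrow> x 0 = 0 \<and> decoupled_run D Xf X0bar i (\<lambda>t. x t - xb)"

definition shift_back where
  "shift_back D Xf X0bar i xb x \<longleftrightarrow> x 0 = xb \<and> decoupled_run D Xf X0bar i x"

definition no_spatial_intersection ::
  "('n::finite, 'm::finite, 'i::finite) dmpc \<Rightarrow> ('i \<Rightarrow> (real ^ 'n) set) \<Rightarrow> ('i \<Rightarrow> (real ^ 'n) set) \<Rightarrow> bool" where
  "no_spatial_intersection D Xf X0bar \<longleftrightarrow>
     (\<Inter>i. occupied D X0bar i) = {} \<and>
     (\<forall>xm um x0. alg_init D Xf xm um x0 \<and> (\<forall>i. x0 i \<in> X0bar i) \<longrightarrow>
        (\<exists>x u. x 0 = x0 \<and> alg_run D Xf X0bar xm um x u) \<and>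
        (\<forall>x u. x 0 = x0 \<and> alg_run D Xf X0bar xm um x u \<longrightarrow>
           (\<forall>t i. spatial D (refst D i + x t i) \<in> occupied D X0bar i)))"

definition shift_stays ::
  "('n::finite, 'm::finite, 'i::finite) dmpc \<Rightarrow> ('i \<Rightarrow> (real ^ 'n) set) \<Rightarrow> ('i \<Rightarrow> (real ^ 'n) set)
    \<Rightarrow> 'i \<Rightarrow> real ^ 'n \<Rightarrow> bool" where
  "shift_stays D Xf X0bar i xb \<longleftrightarrow>
     (\<exists>x. shift_to D Xf X0bar i xb x) \<and> (\<exists>x. shift_back D Xf X0bar i xb x) \<and>
     (\<forall>x. shift_to D Xf X0bar i xb x \<or> shift_back D Xf X0bar i xb x \<longrightarrow> (\<forall>t. x t \<in> X0bar i))"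

end

theory Submission
  imports Defs
begin

text \<open>Take each set \<open>X0bar i\<close> equal to the terminal set itself; if the terminal sets meet in space,
  first scale all of them towards \<open>0\<close>. A subsystem starting in the terminal set then stays there, as
  the algorithm only ever solves the decoupled problem, whose first predicted state is constrained to
  the terminal set. For the shift, the optimal cost is a Lyapunov function lying between two multiples
  of the squared norm, so the translated error never exceeds a fixed multiple of \<open>norm xb\<close>, and for
  small \<open>xb\<close> the original state stays in a ball contained in the terminal set.\<close>

section \<open>Weighted norms\<close>

lemma wnorm2_scaleR: "wnorm2 S (c *\<^sub>R x) = c\<^sup>2 * wnorm2 S x"
  by (simp add: wnorm2_def matrix_vector_mult_scaleR power2_eq_square)

lemma wnorm2_nonneg:
  assumes "posdef S"
  shows "0 \<le> wnorm2 S x"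
  using assms by (cases "x = 0") (auto simp: posdef_def wnorm2_def less_imp_le)

lemma continuous_on_wnorm2 [continuous_intros]:
  assumes "continuous_on T f"
  shows "continuous_on T (\<lambda>x. wnorm2 S (f x))"
  unfolding wnorm2_def
  by (intro continuous_intros assms
      bounded_linear.continuous_on [OF matrix_vector_mul_bounded_linear])

text \<open>By continuity the form attains its minimum on the compact unit sphere. Definiteness
  makes this minimum positive, and homogeneity of degree two carries the bound to all
  vectors.\<close>

lemma wnorm2_lower_bound:
  fixes S :: "real ^ 'k ^ 'k"
  assumes "posdef S"
  shows "\<exists>c>0. \<forall>x. c * (norm x)\<^sup>2 \<le> wnorm2 S x"
proof -
  have "\<exists>y \<in> sphere 0 1. \<forall>z \<in> sphere 0 1. wnorm2 S y \<le> wnorm2 S z"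
    by (intro continuous_attains_inf continuous_on_wnorm2 continuous_on_id) auto
  then obtain y where y: "y \<in> sphere 0 1" "\<And>z. z \<in> sphere 0 1 \<Longrightarrow> wnorm2 S y \<le> wnorm2 S z"
    by blast
  have "y \<noteq> 0"
    using y(1) by auto
  then have "0 < wnorm2 S y"
    using assms by (simp add: posdef_def wnorm2_def)
  moreover have "wnorm2 S y * (norm x)\<^sup>2 \<le> wnorm2 S x" for x
  proof (cases "x = 0")
    case False
    define z where "z = x /\<^sub>R norm x"
    have z: "z \<in> sphere 0 1" "x = norm x *\<^sub>R z"
      using False by (auto simp: z_def)
    have "wnorm2 S x = (norm x)\<^sup>2 * wnorm2 S z"
      by (subst z(2)) (rule wnorm2_scaleR)
    then show ?thesis
      using mult_right_mono [OF y(2) [OF z(1)], of "(norm x)\<^sup>2"] by (simp add: mult.commute)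
  qed (simp add: wnorm2_def)
  ultimately show ?thesis
    by blast
qed

lemma wnorm2_upper_bound:
  fixes S :: "real ^ 'k ^ 'k"
  shows "\<exists>C>0. \<forall>x. wnorm2 S x \<le> C * (norm x)\<^sup>2"
proof -
  obtain C where C: "C > 0" "\<And>x. norm (S *v x) \<le> norm x * C"
    using bounded_linear.pos_bounded [OF matrix_vector_mul_bounded_linear] by blast
  have "wnorm2 S x \<le> C * (norm x)\<^sup>2" for x
  proof -
    have "wnorm2 S x \<le> norm x * norm (S *v x)"
      unfolding wnorm2_def by (rule norm_cauchy_schwarz)
    also have "\<dots> \<le> norm x * (norm x * C)"
      by (intro mult_left_mono C norm_ge_zero)
    finally show ?thesis
      by (simp add: power2_eq_square algebra_simps)
  qed
  with C(1) show ?thesis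
    by blast
qed

section \<open>The decoupled problem\<close>

text \<open>The constraint inside \<open>decoupled_optimal\<close> gets a name of its own, so that
  an optimizer can be compared with explicitly built feasible candidates.\<close>

definition decoupled_feasible ::
  "('n::finite, 'm::finite, 'i::finite) dmpc \<Rightarrow> ('i \<Rightarrow> (real ^ 'n) set) \<Rightarrow> ('i \<Rightarrow> (real ^ 'n) set)
    \<Rightarrow> 'i \<Rightarrow> real ^ 'n \<Rightarrow> (nat \<Rightarrow> real ^ 'm) \<Rightarrow> bool" where
  "decoupled_feasible D Xf X0bar i x u \<longleftrightarrow>
     (\<forall>k < horizon D. predicted D x u k \<in> X0bar i \<and> u k \<in> inputU D i) \<and>
     predicted D x u (horizon D) \<in> Xf i"

lemma decoupled_optimal_iff:
  "decoupled_optimal D Xf X0bar i x u \<longleftrightarrow>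
     decoupled_feasible D Xf X0bar i x u \<and>
     (\<forall>v. decoupled_feasible D Xf X0bar i x v \<longrightarrow> decoupled_cost D x u \<le> decoupled_cost D x v)"
  unfolding decoupled_optimal_def decoupled_feasible_def is_arg_min_linorder by blast

lemma predicted_0 [simp]: "predicted D x u 0 = x"
  by (simp add: predicted_def)

lemma predicted_Suc [simp]:
  "predicted D x u (Suc k) = dynA D *v predicted D x u k + dynB D *v u k"
  by (simp add: predicted_def)

lemma predicted_cong: "(\<And>j. j < k \<Longrightarrow> u j = v j) \<Longrightarrow> predicted D x u k = predicted D x v k"
  by (induction k) auto

text \<open>The tail of an input sequence, restarted at the successor state, reproduces the tail of
  the trajectory. The candidate at the next time step is built on this.\<close>

lemma predicted_Suc_shift:
  "predicted D (dynA D *v x + dynB D *v u 0) (\<lambda>k. u (Suc k)) k = predicted D x u (Suc k)"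
  by (induction k) auto

text \<open>Input sequences are functions on all naturals. Entries from the horizon on may be
  altered freely, which later allows them to be reset to 0.\<close>

lemma decoupled_cost_cong:
  assumes "\<And>k. k < horizon D \<Longrightarrow> u k = v k"
  shows "decoupled_cost D x u = decoupled_cost D x v"
proof -
  have "predicted D x u k = predicted D x v k" if "k \<le> horizon D" for k
    using that assms by (intro predicted_cong) auto
  then show ?thesis
    using assms by (auto simp: decoupled_cost_def intro!: sum.cong)
qed

lemma decoupled_feasible_cong:
  assumes "\<And>k. k < horizon D \<Longrightarrow> u k = v k"
  shows "decoupled_feasible D Xf X0bar i x u \<longleftrightarrow> decoupled_feasible D Xf X0bar i x v"
proof -
  have "predicted D x u k = predicted D x v k" if "k \<le> horizon D" for k
    using that assms by (intro predicted_cong) auto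
  then show ?thesis
    using assms by (auto simp: decoupled_feasible_def)
qed

section \<open>Existence of optimizers by compactness\<close>

lemma continuous_on_predicted [continuous_intros]:
  "continuous_on UNIV (\<lambda>u. predicted D x u k)"
  by (induction k)
    (auto intro!: continuous_intros bounded_linear.continuous_on [OF matrix_vector_mul_bounded_linear])

lemma continuous_on_decoupled_cost: "continuous_on UNIV (decoupled_cost D x)"
  unfolding decoupled_cost_def [abs_def]
  by (intro continuous_intros continuous_on_product_coordinates)

text \<open>Tychonoff's theorem: the topology on functions is the product topology, so all sequences
  in a compact set form a compact set.\<close>

lemma compact_sequences:
  fixes U :: "'a::topological_space set"
  assumes "compact U"
  shows "compact {u :: nat \<Rightarrow> 'a. \<forall>k. u k \<in> U}"
proof -
  have "compactin (product_topology (\<lambda>_. euclidean) UNIV) (PiE UNIV (\<lambda>_::nat. U))"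
    using assms by (simp add: compactin_PiE)
  then have "compact (PiE UNIV (\<lambda>_::nat. U))"
    by (simp add: euclidean_product_topology)
  moreover have "PiE UNIV (\<lambda>_::nat. U) = {u. \<forall>k. u k \<in> U}"
    by (auto simp: PiE_def)
  ultimately show ?thesis
    by simp
qed

text \<open>A continuous cost attains its infimum on a compact nonempty feasible set.\<close>

lemma decoupled_optimal_exists:
  assumes feas: "decoupled_feasible D Xf X0bar i x w"
    and U: "compact (inputU D i)" "0 \<in> inputU D i"
    and "closed (X0bar i)" "closed (Xf i)"
  shows "\<exists>u. decoupled_optimal D Xf X0bar i x u"
proof -
  \<comment> \<open>Feasibility leaves the entries beyond the horizon free, so the feasible set
    itself need not be compact. Every entry is therefore required to lie in
    \<open>inputU D i\<close>; since 0 is admissible, truncation moves any feasible sequence into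
    \<open>F\<close> at the same cost.\<close>
  let ?trunc = "\<lambda>u k. if k < horizon D then u k else 0"
  define F where "F = {u. \<forall>k. u k \<in> inputU D i} \<inter>
    ((\<Inter>k<horizon D. (\<lambda>u. predicted D x u k) -` X0bar i) \<inter>
     (\<lambda>u. predicted D x u (horizon D)) -` Xf i)"
  have "closed ((\<lambda>u. predicted D x u k) -` C)" if "closed C" for C k
    using that continuous_on_predicted [of D x k]
    by (metis Int_UNIV_right closed_UNIV continuous_on_closed_vimage)
  then have "compact F"
    unfolding F_def using assms
    by (intro compact_Int_closed compact_sequences closed_Int closed_INT) auto
  have trunc: "?trunc v \<in> F" if "decoupled_feasible D Xf X0bar i x v" for v
  proof -
    have "decoupled_feasible D Xf X0bar i x (?trunc v)"
      using that by (subst decoupled_feasible_cong [of D _ v]) auto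
    with U(2) show ?thesis
      by (auto simp: F_def decoupled_feasible_def)
  qed
  obtain u where u: "u \<in> F" "\<And>v. v \<in> F \<Longrightarrow> decoupled_cost D x u \<le> decoupled_cost D x v"
    using continuous_attains_inf [OF \<open>compact F\<close>] trunc [OF feas]
      continuous_on_subset [OF continuous_on_decoupled_cost] by blast
  have "decoupled_feasible D Xf X0bar i x u"
    using u(1) by (auto simp: F_def decoupled_feasible_def)
  moreover have "decoupled_cost D x u \<le> decoupled_cost D x v"
    if "decoupled_feasible D Xf X0bar i x v" for v
  proof -
    have "decoupled_cost D x (?trunc v) = decoupled_cost D x v"
      by (rule decoupled_cost_cong) simp
    with u(2) [OF trunc [OF that]] show ?thesis
      by simp
  qed
  ultimately show ?thesis
    by (auto simp: decoupled_optimal_iff)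
qed

section \<open>The terminal sets as feasible sets\<close>

lemma terminal_sets_step:
  assumes "terminal_sets D Xf" "x \<in> Xf i"
  shows "gainK D *v x \<in> inputU D i"
    and "dynA D *v x + dynB D *v (gainK D *v x) \<in> Xf i"
    and "wnorm2 (wQ D) x + wnorm2 (wR D) (gainK D *v x)
           + wnorm2 (wP D) (dynA D *v x + dynB D *v (gainK D *v x)) \<le> wnorm2 (wP D) x"
  using assms by (fastforce simp: terminal_sets_def Let_def)+

lemma constraint_polyhedron_0_in: "constraint_polyhedron S \<Longrightarrow> 0 \<in> S"
  using interior_subset by (auto simp: constraint_polyhedron_def)

lemma terminal_sets_constraint:
  assumes "terminal_sets D Xf"
  shows "closed (Xf i)" "0 \<in> interior (Xf i)" "Xf i \<subseteq> stateX D i"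
  using assms by (auto simp: terminal_sets_def constraint_polyhedron_def compact_imp_closed)

text \<open>The open-loop sequence that the terminal feedback generates along its own trajectory,
  written through iterates of the closed-loop map to avoid circularity.\<close>

definition feedback_inputs ::
  "('n::finite, 'm::finite, 'i::finite) dmpc \<Rightarrow> real ^ 'n \<Rightarrow> nat \<Rightarrow> real ^ 'm" where
  "feedback_inputs D x k =
     gainK D *v (((\<lambda>z. dynA D *v z + dynB D *v (gainK D *v z)) ^^ k) x)"

lemma feedback_inputs_eq: "feedback_inputs D x k = gainK D *v predicted D x (feedback_inputs D x) k"
proof -
  have "predicted D x (feedback_inputs D x) k =
      ((\<lambda>z. dynA D *v z + dynB D *v (gainK D *v z)) ^^ k) x"
    by (induction k) (auto simp: feedback_inputs_def)
  then show ?thesis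
    by (simp add: feedback_inputs_def)
qed

lemma predicted_feedback_in:
  assumes "terminal_sets D Xf" "x \<in> Xf i"
  shows "predicted D x (feedback_inputs D x) k \<in> Xf i"
proof (induction k)
  case (Suc k)
  then show ?case
    using terminal_sets_step(2) [OF assms(1) Suc] feedback_inputs_eq [of D x k] by simp
qed (simp add: assms)

text \<open>The terminal set is invariant under the feedback, so it can serve as state constraint
  and as terminal constraint at once.\<close>

lemma decoupled_feasible_feedback:
  assumes "terminal_sets D Xf" "x \<in> Xf i"
  shows "decoupled_feasible D Xf Xf i x (feedback_inputs D x)"
  using predicted_feedback_in [OF assms]
    terminal_sets_step(1) [OF assms(1) predicted_feedback_in [OF assms]]
  unfolding decoupled_feasible_def by (metis feedback_inputs_eq)

text \<open>The terminal inequality telescopes: the cost accumulated over \<open>n\<close> steps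
  plus the terminal weight at step \<open>n\<close> never exceeds the initial terminal
  weight.\<close>

lemma decoupled_cost_feedback_le:
  assumes "terminal_sets D Xf" "x \<in> Xf i"
  shows "decoupled_cost D x (feedback_inputs D x) \<le> wnorm2 (wP D) x"
proof -
  let ?z = "predicted D x (feedback_inputs D x)"
  have "(\<Sum>k<n. wnorm2 (wQ D) (?z k) + wnorm2 (wR D) (feedback_inputs D x k))
      + wnorm2 (wP D) (?z n) \<le> wnorm2 (wP D) x" for n
  proof (induction n)
    case (Suc n)
    show ?case
      using terminal_sets_step(3) [OF assms(1) predicted_feedback_in [OF assms, of n]] Suc
        feedback_inputs_eq [of D x n] by simp
  qed simp
  then show ?thesis
    by (simp add: decoupled_cost_def)
qed

lemma decoupled_optimal_exists_terminal:
  assumes "standing_assumptions D" "terminal_sets D Xf" "x \<in> Xf i"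
  shows "\<exists>u. decoupled_optimal D Xf Xf i x u"
proof (rule decoupled_optimal_exists)
  show "decoupled_feasible D Xf Xf i x (feedback_inputs D x)"
    using assms by (intro decoupled_feasible_feedback)
  have "constraint_polyhedron (inputU D i)"
    using assms(1) by (simp add: standing_assumptions_def)
  then show "compact (inputU D i)" "0 \<in> inputU D i"
    using constraint_polyhedron_0_in by (simp add: constraint_polyhedron_def, blast)
qed (use terminal_sets_constraint [OF assms(2)] in auto)

lemma decoupled_optimal_next_in:
  assumes "standing_assumptions D" "decoupled_optimal D Xf X0bar i x u"
  shows "dynA D *v x + dynB D *v u 0 \<in> X0bar i"
proof -
  \<comment> \<open>As the horizon is at least 2, index 1 is still strictly before it, and the state
    constraint applies to the first predicted successor.\<close>
  have "1 < horizon D"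
    using assms(1) by (auto simp: standing_assumptions_def)
  then have "predicted D x u 1 \<in> X0bar i"
    using assms(2) by (auto simp: decoupled_optimal_iff decoupled_feasible_def)
  then show ?thesis
    by simp
qed

text \<open>The candidate at the successor state is the shifted optimal sequence, continued by the terminal
  feedback.\<close>

lemma decoupled_cost_decreases:
  assumes "standing_assumptions D" "terminal_sets D Xf"
    and u: "decoupled_optimal D Xf Xf i x u"
    and u': "decoupled_optimal D Xf Xf i (dynA D *v x + dynB D *v u 0) u'"
  shows "decoupled_cost D (dynA D *v x + dynB D *v u 0) u' \<le> decoupled_cost D x u"
proof -
  let ?x' = "dynA D *v x + dynB D *v u 0"
  have "0 < horizon D"
    using assms(1) by (auto simp: standing_assumptions_def)
  then obtain n where n: "horizon D = Suc n"
    by (cases "horizon D") auto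
  define xN where "xN = predicted D x u (Suc n)"
  \<comment> \<open>With horizon \<open>n + 1\<close>, the shift leaves \<open>n\<close> old inputs
    for the indices below \<open>n\<close>; the feedback at \<open>xN\<close> fills the last index
    \<open>n\<close>.\<close>
  define v where "v k = (if k < n then u (Suc k) else gainK D *v xN)" for k
  have feas: "\<And>k. k \<le> n \<Longrightarrow> predicted D x u k \<in> Xf i" "\<And>k. k \<le> n \<Longrightarrow> u k \<in> inputU D i"
    and xN: "xN \<in> Xf i"
    using u n by (auto simp: decoupled_optimal_iff decoupled_feasible_def xN_def less_Suc_eq_le)
  note step = terminal_sets_step [OF assms(2) xN]
  have pred: "predicted D ?x' v k = predicted D x u (Suc k)" if "k \<le> n" for k
  proof -
    have "predicted D ?x' v k = predicted D ?x' (\<lambda>k. u (Suc k)) k"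
      using that by (intro predicted_cong) (simp add: v_def)
    then show ?thesis
      by (simp only: predicted_Suc_shift)
  qed
  have vn: "v n = gainK D *v xN"
    by (simp add: v_def)
  have pred_n: "predicted D ?x' v n = xN"
    using pred [of n] by (simp only: xN_def order_refl)
  have pred_N: "predicted D ?x' v (Suc n) = dynA D *v xN + dynB D *v (gainK D *v xN)"
    by (simp only: predicted_Suc pred_n vn)
  have "decoupled_feasible D Xf Xf i ?x' v"
    unfolding decoupled_feasible_def n
  proof (intro conjI allI impI)
    fix k
    assume "k < Suc n"
    show "predicted D ?x' v k \<in> Xf i"
    \<comment> \<open>At index \<open>n\<close> the candidate is at \<open>xN\<close>, known only
      from the terminal constraint of \<open>u\<close>; this suffices because the terminal set is
      also the state constraint.\<close>
    proof (cases "k = n")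
      case True
      then show ?thesis
        using pred_n xN by simp
    next
      case False
      then show ?thesis
        using \<open>k < Suc n\<close> pred [of k] feas(1) [of "Suc k"] by simp
    qed
    show "v k \<in> inputU D i"
      using \<open>k < Suc n\<close> feas(2) step(1) by (simp add: v_def)
  next
    show "predicted D ?x' v (Suc n) \<in> Xf i"
      using step(2) by (simp only: pred_N)
  qed
  then have "decoupled_cost D ?x' u' \<le> decoupled_cost D ?x' v"
    using u' by (auto simp: decoupled_optimal_iff)
  also have "\<dots> = (\<Sum>k<n. wnorm2 (wQ D) (predicted D x u (Suc k)) + wnorm2 (wR D) (u (Suc k)))
      + wnorm2 (wQ D) xN + wnorm2 (wR D) (gainK D *v xN)
      + wnorm2 (wP D) (dynA D *v xN + dynB D *v (gainK D *v xN))"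
  proof -
    have "(\<Sum>k<n. wnorm2 (wQ D) (predicted D ?x' v k) + wnorm2 (wR D) (v k)) =
        (\<Sum>k<n. wnorm2 (wQ D) (predicted D x u (Suc k)) + wnorm2 (wR D) (u (Suc k)))"
      by (intro sum.cong refl) (simp only: pred v_def lessThan_iff less_imp_le if_True)
    then show ?thesis
      by (simp only: decoupled_cost_def n sum.lessThan_Suc pred_N pred_n vn add.assoc)
  qed
  \<comment> \<open>The terminal inequality at \<open>xN\<close> absorbs the appended stage. What
    remains is the old cost without its nonnegative first stage.\<close>
  also have "\<dots> \<le> (\<Sum>k<n. wnorm2 (wQ D) (predicted D x u (Suc k)) + wnorm2 (wR D) (u (Suc k)))
      + wnorm2 (wP D) xN"
    using step(3) by linarith
  also have "\<dots> \<le> decoupled_cost D x u"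
  proof -
    have "0 \<le> wnorm2 (wQ D) x" "0 \<le> wnorm2 (wR D) (u 0)"
      using assms(1) by (auto simp: standing_assumptions_def intro!: wnorm2_nonneg)
    then show ?thesis
      unfolding decoupled_cost_def n sum.lessThan_Suc_shift xN_def by simp
  qed
  finally show ?thesis .
qed

text \<open>The stage at index 0 already contains this term, and all other terms are
  nonnegative.\<close>

lemma wnorm2_le_decoupled_cost:
  assumes "standing_assumptions D"
  shows "wnorm2 (wQ D) x \<le> decoupled_cost D x u"
proof -
  have pos: "posdef (wQ D)" "posdef (wR D)" "posdef (wP D)" and "0 < horizon D"
    using assms by (auto simp: standing_assumptions_def)
  have "wnorm2 (wQ D) (predicted D x u 0) + wnorm2 (wR D) (u 0)
      \<le> (\<Sum>k<horizon D. wnorm2 (wQ D) (predicted D x u k) + wnorm2 (wR D) (u k))"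
    using \<open>0 < horizon D\<close> pos
    by (intro member_le_sum [of 0 "{..<horizon D}"
          "\<lambda>k. wnorm2 (wQ D) (predicted D x u k) + wnorm2 (wR D) (u k)"])
      (auto intro!: add_nonneg_nonneg wnorm2_nonneg)
  then show ?thesis
    using wnorm2_nonneg [OF pos(2), of "u 0"]
      wnorm2_nonneg [OF pos(3), of "predicted D x u (horizon D)"]
    by (simp add: decoupled_cost_def)
qed

section \<open>Closed loops in the terminal sets\<close>

text \<open>Recursive feasibility: an optimizer exists at every state of the terminal set and keeps
  the successor there, so a chosen optimal law can be iterated forever.\<close>

lemma decoupled_run_exists:
  assumes "standing_assumptions D" "terminal_sets D Xf" "x0 \<in> Xf i"
  shows "\<exists>x. x 0 = x0 \<and> decoupled_run D Xf Xf i x"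
proof -
  define law where "law x = (SOME u. decoupled_optimal D Xf Xf i x u)" for x
  have law: "decoupled_optimal D Xf Xf i x (law x)" if "x \<in> Xf i" for x
    unfolding law_def
    by (rule someI_ex [of "decoupled_optimal D Xf Xf i x"])
      (rule decoupled_optimal_exists_terminal [OF assms(1,2) that])
  define x where "x t = ((\<lambda>z. dynA D *v z + dynB D *v law z 0) ^^ t) x0" for t
  have x_Suc: "x (Suc t) = dynA D *v x t + dynB D *v law (x t) 0" for t
    by (simp add: x_def)
  have "x t \<in> Xf i" for t
  proof (induction t)
    case (Suc t)
    then show ?case
      using decoupled_optimal_next_in [OF assms(1) law] by (simp add: x_Suc)
  qed (simp add: x_def assms)
  then have "decoupled_run D Xf Xf i x"
    using law x_Suc unfolding decoupled_run_def by blast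
  moreover have "x 0 = x0"
    by (simp add: x_def)
  ultimately show ?thesis
    by blast
qed

text \<open>The constraint at index 0 concerns the current state itself, so the mere existence of an
  optimizer places that state in \<open>X0bar i\<close>.\<close>

lemma decoupled_run_in:
  assumes "standing_assumptions D" "decoupled_run D Xf X0bar i x"
  shows "x t \<in> X0bar i"
proof -
  obtain u where "decoupled_optimal D Xf X0bar i (x t) u"
    using assms(2) by (auto simp: decoupled_run_def)
  moreover have "0 < horizon D"
    using assms(1) by (auto simp: standing_assumptions_def)
  ultimately show ?thesis
    by (force simp: decoupled_optimal_iff decoupled_feasible_def)
qed

text \<open>The optimal cost does not increase along the run. It dominates the \<open>wQ\<close>
  form of the current state and starts below the cost of the feedback candidate, hence below the
  \<open>wP\<close> form of the initial state.\<close>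

lemma decoupled_run_wnorm2_le:
  assumes "standing_assumptions D" "terminal_sets D Xf" "decoupled_run D Xf Xf i y"
  shows "wnorm2 (wQ D) (y t) \<le> wnorm2 (wP D) (y 0)"
proof -
  obtain u where u: "\<And>t. decoupled_optimal D Xf Xf i (y t) (u t)"
    and y_Suc: "\<And>t. y (Suc t) = dynA D *v y t + dynB D *v u t 0"
    using assms(3) unfolding decoupled_run_def by metis
  have "y 0 \<in> Xf i"
    by (rule decoupled_run_in [OF assms(1,3)])
  have "decoupled_cost D (y t) (u t) \<le> wnorm2 (wP D) (y 0)"
  proof (induction t)
    case 0
    have "decoupled_cost D (y 0) (u 0) \<le> decoupled_cost D (y 0) (feedback_inputs D (y 0))"
      using u [of 0] decoupled_feasible_feedback [OF assms(2) \<open>y 0 \<in> Xf i\<close>]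
      by (auto simp: decoupled_optimal_iff)
    also have "\<dots> \<le> wnorm2 (wP D) (y 0)"
      by (rule decoupled_cost_feedback_le [OF assms(2) \<open>y 0 \<in> Xf i\<close>])
    finally show ?case .
  next
    case (Suc t)
    then show ?case
      using decoupled_cost_decreases [OF assms(1,2) u [of t], of "u (Suc t)"] u [of "Suc t"]
      by (simp add: y_Suc)
  qed
  then show ?thesis
    using wnorm2_le_decoupled_cost [OF assms(1), of "y t" "u t"] by linarith
qed

lemma decoupled_run_norm_bound:
  assumes "standing_assumptions D" "terminal_sets D Xf"
  shows "\<exists>c>0. \<forall>i y t. decoupled_run D Xf Xf i y \<longrightarrow> norm (y t) \<le> c * norm (y 0)"
proof -
  have "posdef (wQ D)"
    using assms(1) by (auto simp: standing_assumptions_def)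
  then obtain q where q: "q > 0" "\<And>x. q * (norm x)\<^sup>2 \<le> wnorm2 (wQ D) x"
    using wnorm2_lower_bound by blast
  obtain p where p: "p > 0" "\<And>x. wnorm2 (wP D) x \<le> p * (norm x)\<^sup>2"
    using wnorm2_upper_bound by blast
  \<comment> \<open>The constants come from \<open>wP\<close> and \<open>wQ\<close> alone, which all
    subsystems share, so the bound is uniform in \<open>i\<close>, \<open>y\<close> and
    \<open>t\<close>.\<close>
  have "norm (y t) \<le> sqrt (p / q) * norm (y 0)" if run: "decoupled_run D Xf Xf i y" for i y t
  proof (rule power2_le_imp_le)
    have "q * (norm (y t))\<^sup>2 \<le> p * (norm (y 0))\<^sup>2"
      using q(2) [of "y t"] p(2) [of "y 0"] decoupled_run_wnorm2_le [OF assms run, of t]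
      by linarith
    then have "(norm (y t))\<^sup>2 \<le> p / q * (norm (y 0))\<^sup>2"
      using q(1) by (simp add: field_simps)
    also have "\<dots> = (sqrt (p / q) * norm (y 0))\<^sup>2"
      using p(1) q(1) by (simp add: power_mult_distrib)
    finally show "(norm (y t))\<^sup>2 \<le> (sqrt (p / q) * norm (y 0))\<^sup>2" .
    show "0 \<le> sqrt (p / q) * norm (y 0)"
      using p(1) q(1) by simp
  qed
  moreover have "sqrt (p / q) > 0"
    using p(1) q(1) by simp
  ultimately show ?thesis
    by blast
qed

section \<open>State shifts to and from nearby avoidance states\<close>

lemma common_cball_in_interiors:
  fixes C :: "'i::finite \<Rightarrow> 'a::real_normed_vector set"
  assumes "\<And>i. 0 \<in> interior (C i)"
  shows "\<exists>s>0. \<forall>i. cball 0 s \<subseteq> C i"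
proof -
  have "open (\<Inter>i. interior (C i))" "0 \<in> (\<Inter>i. interior (C i))"
    using assms by (auto intro!: open_INT)
  then obtain s where "s > 0" "cball 0 s \<subseteq> (\<Inter>i. interior (C i))"
    by (meson open_contains_cball)
  then show ?thesis
    using interior_subset by (metis INT_subset_iff UNIV_I order_trans)
qed

lemma shift_stays_near_0:
  assumes "standing_assumptions D" "terminal_sets D Xf"
  shows "\<exists>r>0. \<forall>i. \<forall>xb \<in> cball 0 r. shift_stays D Xf Xf i xb"
proof -
  obtain c where c: "c > 0"
    "\<And>i y t. decoupled_run D Xf Xf i y \<Longrightarrow> norm (y t) \<le> c * norm (y 0)"
    using decoupled_run_norm_bound [OF assms] by blast
  obtain s where s: "s > 0" "\<And>i. cball 0 s \<subseteq> Xf i"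
    using common_cball_in_interiors [of Xf] terminal_sets_constraint(2) [OF assms(2)] by blast
  \<comment> \<open>Chosen so that \<open>c * r + r = s\<close>: the translated error may reach
    \<open>c * r\<close>, and undoing the translation adds at most \<open>r\<close>. In particular
    \<open>r \<le> s\<close>, so both starting points \<open>- xb\<close> and \<open>xb\<close> lie
    in the terminal set.\<close>
  define r where "r = s / (c + 1)"
  have r: "0 < r" "c * r + r = s"
    using c(1) s(1) by (simp_all add: r_def add_divide_distrib [symmetric] field_simps)
  then have "r \<le> s"
    using c(1) by (smt (verit) mult_pos_pos)
  have "shift_stays D Xf Xf i xb" if xb: "norm xb \<le> r" for i xb
    unfolding shift_stays_def
  proof (intro conjI allI impI)
    have "- xb \<in> Xf i" "xb \<in> Xf i"
      using xb \<open>r \<le> s\<close> s(2) [of i] by (auto simp: subset_iff)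
    obtain y where "y 0 = - xb" "decoupled_run D Xf Xf i y"
      using decoupled_run_exists [OF assms \<open>- xb \<in> Xf i\<close>] by blast
    then have "shift_to D Xf Xf i xb (\<lambda>t. y t + xb)"
      by (simp add: shift_to_def)
    then show "\<exists>x. shift_to D Xf Xf i xb x"
      by blast
    show "\<exists>x. shift_back D Xf Xf i xb x"
      using decoupled_run_exists [OF assms \<open>xb \<in> Xf i\<close>] by (auto simp: shift_back_def)
  next
    fix x t
    assume "shift_to D Xf Xf i xb x \<or> shift_back D Xf Xf i xb x"
    then show "x t \<in> Xf i"
    proof
      assume "shift_to D Xf Xf i xb x"
      \<comment> \<open>The run constrains only the translated error, so membership of
        \<open>x t\<close> itself has to come from a norm estimate; the error starts at
        \<open>- xb\<close>.\<close>
      then have "norm (x t - xb) \<le> c * norm xb"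
        using c(2) [of i "\<lambda>t. x t - xb" t] by (simp add: shift_to_def)
      also have "\<dots> \<le> c * r"
        using xb c(1) by simp
      finally have "norm (x t) \<le> s"
        using r(2) xb norm_triangle_sub [of "x t" xb] by linarith
      then show ?thesis
        using s(2) [of i] by (auto simp: subset_iff)
    next
      assume "shift_back D Xf Xf i xb x"
      then show ?thesis
        using decoupled_run_in [OF assms(1)] by (auto simp: shift_back_def)
    qed
  qed
  with r(1) show ?thesis
    by auto
qed

section \<open>Runs of the switched-cost algorithm\<close>

lemma alg_run_in:
  assumes "standing_assumptions D" "alg_run D Xf Xf xm um x u" "\<And>i. x 0 i \<in> Xf i"
  shows "x t i \<in> Xf i"
proof (induction t arbitrary: i)
  case (Suc t)
  \<comment> \<open>By induction all states at time \<open>t\<close> lie in their terminal sets, so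
    the switch selects the decoupled problem.\<close>
  then have "\<forall>i. decoupled_optimal D Xf Xf i (x t i) (u t i)"
    using assms(2) by (auto simp: alg_run_def Let_def)
  then have "dynA D *v x t i + dynB D *v u t i 0 \<in> Xf i"
    using decoupled_optimal_next_in [OF assms(1)] by blast
  then show ?case
    using assms(2) by (simp add: alg_run_def)
qed (rule assms)

text \<open>Independent decoupled runs, one per subsystem, together form a run of the algorithm:
  they never leave the terminal sets, so the coupled branch is never entered.\<close>

lemma alg_run_exists:
  assumes "standing_assumptions D" "terminal_sets D Xf"
    and "alg_init D Xf xm um x0" "\<And>i. x0 i \<in> Xf i"
  shows "\<exists>x u. x 0 = x0 \<and> alg_run D Xf Xf xm um x u"
proof -
  obtain y where y: "\<And>i. y i 0 = x0 i" "\<And>i. decoupled_run D Xf Xf i (y i)"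
    using decoupled_run_exists [OF assms(1,2,4)] by metis
  then have "\<forall>t i. \<exists>v. decoupled_optimal D Xf Xf i (y i t) v \<and>
      y i (Suc t) = dynA D *v y i t + dynB D *v v 0"
    unfolding decoupled_run_def by blast
  then obtain u where u: "\<And>t i. decoupled_optimal D Xf Xf i (y i t) (u t i)"
    "\<And>t i. y i (Suc t) = dynA D *v y i t + dynB D *v u t i 0"
    by metis
  have "(\<lambda>i. y i 0) = x0"
    using y(1) by auto
  moreover have "y i t \<in> Xf i" for i t
    by (rule decoupled_run_in [OF assms(1) y(2)])
  ultimately have "alg_run D Xf Xf xm um (\<lambda>t i. y i t) u"
    using assms(3) u by (simp add: alg_run_def Let_def)
  with \<open>(\<lambda>i. y i 0) = x0\<close> show ?thesis
    by (intro exI [of _ "\<lambda>t i. y i t"] exI [of _ u]) simp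
qed

text \<open>The terminal feedback provides both the \<open>horizon D\<close> steps needed for
  \<open>X0set\<close> and the input needed for control invariance.\<close>

lemma X0bar_config_terminal:
  assumes "terminal_sets D Xf"
  shows "X0bar_config D Xf Xf"
proof -
  have "Xf i \<subseteq> X0set D Xf i" for i
    using decoupled_feasible_feedback [OF assms] terminal_sets_constraint(3) [OF assms]
    unfolding X0set_def traj_feasible_def decoupled_feasible_def by blast
  moreover have "\<exists>u \<in> inputU D i. dynA D *v x + dynB D *v u \<in> Xf i" if "x \<in> Xf i" for x i
    using terminal_sets_step(1,2) [OF assms that] by blast
  ultimately show ?thesis
    using assms by (auto simp: X0bar_config_def terminal_sets_def)
qed

lemma no_spatial_intersection_terminal:
  assumes "standing_assumptions D" "terminal_sets D Xf" "(\<Inter>i. occupied D Xf i) = {}"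
  shows "no_spatial_intersection D Xf Xf"
  unfolding no_spatial_intersection_def
proof (intro conjI allI impI)
  fix xm um x0
  assume init: "alg_init D Xf xm um x0 \<and> (\<forall>i. x0 i \<in> Xf i)"
  then show "\<exists>x u. x 0 = x0 \<and> alg_run D Xf Xf xm um x u"
    using alg_run_exists [OF assms(1,2)] by blast
  fix x u t i
  assume "x 0 = x0 \<and> alg_run D Xf Xf xm um x u"
  with init have "x t i \<in> Xf i"
    using alg_run_in [OF assms(1), of Xf xm um x u] by auto
  then show "spatial D (refst D i + x t i) \<in> occupied D Xf i"
    by (auto simp: occupied_def)
qed (rule assms(3))

section \<open>Scaling the terminal sets\<close>

text \<open>Scaling by a positive factor is a linear bijection fixing the origin; such maps preserve
  polyhedra and commute with taking interiors.\<close>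

lemma constraint_polyhedron_scaleR:
  fixes S :: "(real ^ 'k) set"
  assumes "constraint_polyhedron S" "e > 0"
  shows "constraint_polyhedron ((*\<^sub>R) e ` S)"
proof -
  have lin: "linear ((*\<^sub>R) e :: real ^ 'k \<Rightarrow> real ^ 'k)"
    by simp
  have bij: "bij ((*\<^sub>R) e :: real ^ 'k \<Rightarrow> real ^ 'k)"
    using assms(2) by (intro bijI linear_injective_imp_surjective lin) (auto simp: inj_on_def)
  have "(*\<^sub>R) e 0 \<in> (*\<^sub>R) e ` interior S"
    using assms(1) by (auto simp: constraint_polyhedron_def)
  then show ?thesis
    using assms(1) unfolding constraint_polyhedron_def
    by (auto simp: polyhedron_linear_image_eq [OF lin bij] interior_bijective_linear_image [OF lin bij]
        convex_scaling compact_scaling)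
qed

lemma convex_scaleR_subset:
  assumes "convex S" "0 \<in> S" "0 \<le> e" "e \<le> 1"
  shows "(*\<^sub>R) e ` S \<subseteq> S"
  using assms convexD_alt [of S 0 _ e] by auto

text \<open>Linearity of the closed loop makes the scaled sets invariant. Input admissibility and
  the cost inequality are pointwise conditions, inherited because the scaled sets lie in the
  original ones.\<close>

lemma
  assumes "terminal_sets D Xf" "0 < e" "e \<le> 1"
  shows terminal_sets_scaleR: "terminal_sets D (\<lambda>i. (*\<^sub>R) e ` Xf i)"
    and terminal_sets_scaleR_subset: "(*\<^sub>R) e ` Xf i \<subseteq> Xf i"
proof -
  have sub: "(*\<^sub>R) e ` Xf i \<subseteq> Xf i" for i
    using assms constraint_polyhedron_0_in
    by (intro convex_scaleR_subset) (auto simp: terminal_sets_def constraint_polyhedron_def)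
  show "(*\<^sub>R) e ` Xf i \<subseteq> Xf i"
    by (rule sub)
  have K: "gainK D *v (e *\<^sub>R z) = e *\<^sub>R (gainK D *v z)"
    and step: "dynA D *v (e *\<^sub>R z) + dynB D *v (e *\<^sub>R (gainK D *v z))
      = e *\<^sub>R (dynA D *v z + dynB D *v (gainK D *v z))" for z
    by (simp_all add: matrix_vector_mult_scaleR scaleR_right_distrib)
  have "gainK D *v x \<in> inputU D i"
    and "dynA D *v x + dynB D *v (gainK D *v x) \<in> (*\<^sub>R) e ` Xf i"
    and "- wnorm2 (wP D) x + wnorm2 (wQ D) x + wnorm2 (wR D) (gainK D *v x)
      + wnorm2 (wP D) (dynA D *v x + dynB D *v (gainK D *v x)) \<le> 0"
    if x: "x \<in> (*\<^sub>R) e ` Xf i" for x i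
  proof -
    have "x \<in> Xf i"
      using x sub by blast
    note stepx = terminal_sets_step [OF assms(1) this]
    show "gainK D *v x \<in> inputU D i"
      by (rule stepx(1))
    show "- wnorm2 (wP D) x + wnorm2 (wQ D) x + wnorm2 (wR D) (gainK D *v x)
      + wnorm2 (wP D) (dynA D *v x + dynB D *v (gainK D *v x)) \<le> 0"
      using stepx(3) by simp
    obtain z where z: "z \<in> Xf i" "x = e *\<^sub>R z"
      using x by blast
    show "dynA D *v x + dynB D *v (gainK D *v x) \<in> (*\<^sub>R) e ` Xf i"
      using terminal_sets_step(2) [OF assms(1) z(1)] unfolding z(2) K step by blast
  qed
  moreover have "constraint_polyhedron ((*\<^sub>R) e ` Xf i)" for i
    using assms(1,2) by (intro constraint_polyhedron_scaleR) (simp_all add: terminal_sets_def)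
  moreover have "(*\<^sub>R) e ` Xf i \<subseteq> stateX D i" for i
    using sub [of i] terminal_sets_constraint(3) [OF assms(1), of i] by (rule order_trans)
  ultimately show "terminal_sets D (\<lambda>i. (*\<^sub>R) e ` Xf i)"
    unfolding terminal_sets_def Let_def by (intro allI conjI ballI)
qed

section \<open>Separating the spatial projections\<close>

lemma spatial_add: "spatial D (x + y) = spatial D x + spatial D y"
  by (auto simp: spatial_def vec_eq_iff)

lemma norm_spatial_le: "norm (spatial D x) \<le> norm x"
  by (auto simp: norm_vec_def spatial_def intro!: L2_set_mono)

text \<open>Separating one pair of subsystems already empties the intersection over all. Two
  distinct ones exist, and their reference positions differ.\<close>

lemma occupied_scaleR_disjoint:
  fixes D :: "('n::finite, 'm::finite, 'i::finite) dmpc"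
  assumes "standing_assumptions D" "terminal_sets D Xf"
  shows "\<exists>e>0. e \<le> 1 \<and> (\<Inter>i. occupied D (\<lambda>i. (*\<^sub>R) e ` Xf i) i) = {}"
proof -
  have "\<not> (\<forall>i j :: 'i. i = j)"
  proof
    assume "\<forall>i j :: 'i. i = j"
    then have "CARD('i) \<le> 1"
      by (simp add: card_le_Suc0_iff_eq)
    then show False
      using assms(1) by (simp add: standing_assumptions_def)
  qed
  then obtain i j :: 'i where "i \<noteq> j"
    by blast
  define d where "d = norm (spatial D (refst D i) - spatial D (refst D j))"
  have "d > 0"
    using assms(1) \<open>i \<noteq> j\<close> by (auto simp: d_def standing_assumptions_def)
  have "bounded (Xf i \<union> Xf j)"
    using assms(2) by (auto simp: terminal_sets_def constraint_polyhedron_def compact_imp_bounded)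
  then obtain b where b: "b > 0" "\<And>x. x \<in> Xf i \<union> Xf j \<Longrightarrow> norm x \<le> b"
    using bounded_pos by metis
  \<comment> \<open>The scaled projections stay within \<open>d / 3\<close> of their reference
    positions, which are \<open>d\<close> apart, so they cannot meet. The cap at 1 keeps the scaled
    sets inside the original ones.\<close>
  define e where "e = min 1 (d / (3 * b))"
  have e: "0 < e" "e \<le> 1"
    using b(1) \<open>d > 0\<close> by (auto simp: e_def)
  have "e * b \<le> d / (3 * b) * b"
    using b(1) by (intro mult_right_mono) (auto simp: e_def)
  then have eb: "e * b \<le> d / 3"
    using b(1) by simp
  have False if pi: "p \<in> occupied D (\<lambda>i. (*\<^sub>R) e ` Xf i) i"
    and pj: "p \<in> occupied D (\<lambda>i. (*\<^sub>R) e ` Xf i) j" for p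
  proof -
    obtain x where x: "x \<in> Xf i" "p = spatial D (refst D i) + spatial D (e *\<^sub>R x)"
      using pi by (auto simp: occupied_def spatial_add)
    obtain y where y: "y \<in> Xf j" "p = spatial D (refst D j) + spatial D (e *\<^sub>R y)"
      using pj by (auto simp: occupied_def spatial_add)
    have small: "norm (spatial D (e *\<^sub>R z)) \<le> d / 3" if "z \<in> Xf i \<union> Xf j" for z
    proof -
      have "norm (spatial D (e *\<^sub>R z)) \<le> e * norm z"
        using norm_spatial_le [of D "e *\<^sub>R z"] e(1) by simp
      also have "\<dots> \<le> e * b"
        using b(2) [OF that] e(1) by simp
      finally show ?thesis
        using eb by linarith
    qed
    have "spatial D (refst D i) - spatial D (refst D j) = spatial D (e *\<^sub>R y) - spatial D (e *\<^sub>R x)"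
      using x(2) y(2) by (simp add: algebra_simps)
    then have "d \<le> norm (spatial D (e *\<^sub>R y)) + norm (spatial D (e *\<^sub>R x))"
      unfolding d_def by (metis norm_triangle_ineq4)
    also have "\<dots> \<le> d / 3 + d / 3"
      using small x(1) y(1) by (intro add_mono) auto
    finally show False
      using \<open>d > 0\<close> by simp
  qed
  then have "(\<Inter>i. occupied D (\<lambda>i. (*\<^sub>R) e ` Xf i) i) = {}"
    by blast
  with e show ?thesis
    by blast
qed

theorem theorem2:
  fixes D :: "('n::finite, 'm::finite, 'i::finite) dmpc"
    and Xf :: "'i \<Rightarrow> (real ^ 'n) set"
  assumes "standing_assumptions D"
    and "terminal_sets D Xf"
  shows "\<exists>Xf' X0bar.
           terminal_sets D Xf' \<and> (\<forall>i. Xf' i \<subseteq> Xf i) \<and>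
           ((\<Inter>i. occupied D Xf i) = {} \<longrightarrow> Xf' = Xf) \<and>
           X0bar_config D Xf' X0bar \<and>
           no_spatial_intersection D Xf' X0bar \<and>
           (\<exists>r'>0. \<forall>i. \<forall>xb \<in> cball 0 r'. shift_stays D Xf' X0bar i xb)"
proof -
  obtain Xf' where tm: "terminal_sets D Xf'" and disj: "(\<Inter>i. occupied D Xf' i) = {}"
    and sub: "\<forall>i. Xf' i \<subseteq> Xf i" and keep: "(\<Inter>i. occupied D Xf i) = {} \<longrightarrow> Xf' = Xf"
  \<comment> \<open>Terminal sets with empty common projection are kept as they are; otherwise all
    are scaled by one factor.\<close>
  proof (cases "(\<Inter>i. occupied D Xf i) = {}")
    case True
    then show ?thesis
      using that [of Xf] assms(2) by blast
  next
    case False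
    obtain e where "0 < e" "e \<le> 1" "(\<Inter>i. occupied D (\<lambda>i. (*\<^sub>R) e ` Xf i) i) = {}"
      using occupied_scaleR_disjoint [OF assms] by blast
    then show ?thesis
      using that [of "\<lambda>i. (*\<^sub>R) e ` Xf i"] terminal_sets_scaleR [OF assms(2), of e]
        terminal_sets_scaleR_subset [OF assms(2), of e] False by simp
  qed
  \<comment> \<open>The witness for \<open>X0bar\<close> is \<open>Xf'\<close> itself.\<close>
  then show ?thesis
    using X0bar_config_terminal [OF tm] no_spatial_intersection_terminal [OF assms(1) tm disj]
      shift_stays_near_0 [OF assms(1) tm]
    by (intro exI [of _ Xf'] conjI) auto
qed

end
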